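(* For all positive integers $n,r$ and every $T\subseteq[n]$, the polynomial $A^T_{n,r}(x)$ is real-rooted and is interlaced by $A^T_n(x)$.
   Context: An $r$-colored permutation of $[n]$ is a pair $u=w\times\mathbf{z}$ with $w\in\mathfrak{S}_n$ (the symmetric group on $[n]=\{1,\dots,n\}$) and $\mathbf{z}=(z_1,\dots,z_n)\in\{0,1,\dots,r-1\}^n$; the set of these is $\mathfrak{S}_n[\mathbb{Z}_r]$. Setting $w(n+1)=n+1$ and $z_{n+1}=0$, a descent of $u$ is an index $i\in[n]$ such that either $z_i>z_{i+1}$, or $z_i=z_{i+1}$ and $w(i)>w(i+1)$; $\mathrm{Des}(u)$ and $\mathrm{des}(u)$ denote the set and number of descents. For $T\subseteq[n]$, $A^T_{n,r}(x)=\sum_{u\in\mathfrak{S}_n[\mathbb{Z}_r]:\ \mathrm{Des}(u)\subseteq T}x^{\mathrm{des}(u)}$. For $w\in\mathfrak{S}_n$, $\mathrm{Des}(w)=\{i\in[n-1]:w(i)>w(i+1)\}$, $\mathrm{des}(w)=|\mathrm{Des}(w)|$, and $A^T_n(x)=\sum_{w\in\mathfrak{S}_n:\ \mathrm{Des}(w)\subseteq T}x^{\mathrm{des}(w)}$. A polynomial is real-rooted if all its roots are real or it is identically zero. For real-rooted $p$ with roots $\alpha_1\ge\alpha_2\ge\cdots$ and $q$ with roots $\beta_1\ge\beta_2\ge\cdots$, $p$ interlaces $q$ if $\cdots\le\alpha_2\le\beta_2\le\alpha_1\le\beta_1$; the zero polynomial interlaces and is interlaced by every real-rooted polynomial, and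 nonzero constants interlace every polynomial of degree at most one. *)

theory Defs
  imports
    Complex_Main
    "HOL-Combinatorics.Permutations"
    "HOL-Computational_Algebra.Computational_Algebra"
begin

(* A permutation w of [n] is a function with "w permutes {1..n}"; in particular
   w (n + 1) = n + 1. Similarly, colour vectors are functions on nat that vanish
   outside {1..n}, so that z (n + 1) = 0. *)
definition colored_perms :: "nat \<Rightarrow> nat \<Rightarrow> ((nat \<Rightarrow> nat) \<times> (nat \<Rightarrow> nat)) set" where
  "colored_perms n r =
     {w. w permutes {1..n}} \<times>
     {z. (\<forall>i\<in>{1..n}. z i < r) \<and> (\<forall>i. i \<notin> {1..n} \<longrightarrow> z i = 0)}"

definition colored_Des :: "nat \<Rightarrow> (nat \<Rightarrow> nat) \<times> (nat \<Rightarrow> nat) \<Rightarrow> nat set" where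
  "colored_Des n = (\<lambda>(w, z).
     {i \<in> {1..n}. z i > z (i + 1) \<or> (z i = z (i + 1) \<and> w i > w (i + 1))})"

definition colored_des :: "nat \<Rightarrow> (nat \<Rightarrow> nat) \<times> (nat \<Rightarrow> nat) \<Rightarrow> nat" where
  "colored_des n u = card (colored_Des n u)"

definition colored_eulerian :: "nat set \<Rightarrow> nat \<Rightarrow> nat \<Rightarrow> real poly" where
  "colored_eulerian T n r =
     (\<Sum>u | u \<in> colored_perms n r \<and> colored_Des n u \<subseteq> T. monom 1 (colored_des n u))"

definition Des :: "nat \<Rightarrow> (nat \<Rightarrow> nat) \<Rightarrow> nat set" where
  "Des n w = {i \<in> {1..n - 1}. w i > w (i + 1)}"

definition des :: "nat \<Rightarrow> (nat \<Rightarrow> nat) \<Rightarrow> nat" where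
  "des n w = card (Des n w)"

definition eulerian :: "nat set \<Rightarrow> nat \<Rightarrow> real poly" where
  "eulerian T n = (\<Sum>w | w permutes {1..n} \<and> Des n w \<subseteq> T. monom 1 (des n w))"

definition real_rooted :: "real poly \<Rightarrow> bool" where
  "real_rooted p \<longleftrightarrow>
     p = 0 \<or> (\<forall>x::complex. poly (map_poly complex_of_real p) x = 0 \<longrightarrow> x \<in> \<real>)"

(* The real roots, repeated according to multiplicity, in weakly decreasing order. *)
definition roots_desc :: "real poly \<Rightarrow> real list" where
  "roots_desc p = rev (sorted_list_of_multiset (proots p))"

(* For nonzero polynomials, the chain ... \<le> \<alpha>2 \<le> \<beta>2 \<le> \<alpha>1 \<le> \<beta>1 uses up all roots of p and q,
   hence q has as many roots as p or exactly one more. For constant nonzero p this allows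
   exactly the q of degree at most one. *)
definition interlaces :: "real poly \<Rightarrow> real poly \<Rightarrow> bool" where
  "interlaces p q \<longleftrightarrow> real_rooted p \<and> real_rooted q \<and>
     (p = 0 \<or> q = 0 \<or>
      (let \<alpha> = roots_desc p; \<beta> = roots_desc q in
         length \<alpha> \<le> length \<beta> \<and> length \<beta> \<le> length \<alpha> + 1 \<and>
         (\<forall>i < length \<alpha>. \<alpha> ! i \<le> \<beta> ! i) \<and>
         (\<forall>i. i < length \<alpha> \<and> i + 1 < length \<beta> \<longrightarrow> \<beta> ! (i + 1) \<le> \<alpha> ! i)))"

end

theory Submission
  imports Defs "HOL-Real_Asymp.Real_Asymp"
begin

text \<open>
  Let \<open>P k\<close> be the generating polynomial of the permutations of \<open>{1..n + 1}\<close> with last letter \<open>k\<close>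
  and descent set contained in \<open>T\<close>. Standardizing the word of coloured letters, followed by the
  uncoloured letter \<open>n + 1\<close>, preserves descents, and for a fixed assignment of colours to letters it
  is a bijection onto the permutations whose last letter is \<open>n + 1\<close> minus the number of letters
  with nonzero colour. Hence the coloured polynomial is a sum of polynomials \<open>P k\<close>, whereas the
  uncoloured one is \<open>P (n + 1)\<close>, and it suffices that \<open>P (n + 1), \<dots>, P 1\<close> is an interlacing
  sequence. This follows from the usual recursion on \<open>n\<close>: deleting the last letter expresses the
  new polynomials as sums \<open>\<Sum>j<k. P j\<close>, plus \<open>x * (\<Sum>j\<ge>k. P j)\<close> if \<open>n \<in> T\<close>.

  Interlacing of \<open>f\<close> and \<open>g\<close> is expressed by \<open>0 \<le> arg (g z / f z) \<le> arg z\<close> on the upper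
  half-plane, which, cleared of denominators, is a bilinear condition on the two values and hence
  passes to sums. Only at the very end is it translated back to roots: on a horizontal line the
  argument of a real-rooted polynomial is a sum of arctangents, and as the line approaches the real
  axis this sum becomes \<open>\<pi>\<close> times the number of roots to the right.
\<close>

section \<open>An argument condition in the upper half-plane\<close>

text \<open>For \<open>a \<noteq> 0\<close>, \<open>b \<noteq> 0\<close> and \<open>z\<close> in the upper half-plane this says \<open>0 \<le> arg (b / a) \<le> arg z\<close>.\<close>
definition below :: "complex \<Rightarrow> complex \<Rightarrow> complex \<Rightarrow> bool" where
  "below z a b \<longleftrightarrow> 0 \<le> Im (b * cnj a) \<and> 0 \<le> Im (z * a * cnj b)"

lemma below_refl: "0 < Im z \<Longrightarrow> below z a a"
  by (simp add: below_def mult.assoc complex_mult_cnj)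

lemma below_add_left: "below z a c \<Longrightarrow> below z b c \<Longrightarrow> below z (a + b) c"
  by (simp add: below_def distrib_left distrib_right)

lemma below_add_right: "below z a b \<Longrightarrow> below z a c \<Longrightarrow> below z a (b + c)"
  by (simp add: below_def distrib_left distrib_right)

lemma below_sum_left: "(\<And>i. i \<in> S \<Longrightarrow> below z (a i) b) \<Longrightarrow> below z (\<Sum>i\<in>S. a i) b"
proof (induction S rule: infinite_finite_induct)
  case (insert i S)
  then show ?case by (simp add: below_add_left)
qed (simp_all add: below_def)

lemma below_sum_right: "(\<And>i. i \<in> S \<Longrightarrow> below z a (b i)) \<Longrightarrow> below z a (\<Sum>i\<in>S. b i)"
proof (induction S rule: infinite_finite_induct)
  case (insert i S)
  then show ?case by (simp add: below_add_right)
qed (simp_all add: below_def)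

lemma below_sums:
  "(\<And>i j. i \<in> S \<Longrightarrow> j \<in> T \<Longrightarrow> below z (a i) (b j)) \<Longrightarrow> below z (\<Sum>i\<in>S. a i) (\<Sum>j\<in>T. b j)"
  by (intro below_sum_left below_sum_right)

text \<open>The quotient \<open>b / a = - 1\<close> would have argument pi, which exceeds the
  argument of \<open>z\<close>.\<close>

lemma below_add_eq_0:
  assumes "0 < Im z" "below z a b" "a + b = 0"
  shows "a = 0 \<and> b = 0"
proof -
  have b: "b = - a" using assms(3) by (simp add: add_eq_0_iff)
  have "Im (z * a * cnj b) = - (Im z * (cmod a)\<^sup>2)"
    unfolding b cmod_power2 by (simp add: power2_eq_square algebra_simps)
  with assms(2) have "Im z * (cmod a)\<^sup>2 \<le> 0" by (simp add: below_def)
  with assms(1) have "a = 0" by (simp add: mult_le_0_iff)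
  with b show ?thesis by simp
qed

text \<open>The quotient \<open>a / b = - z\<close> would have argument arg \<open>z\<close> - pi,
  which is negative.\<close>

lemma below_add_times_eq_0:
  assumes "0 < Im z" "below z b a" "a + z * b = 0"
  shows "a = 0 \<and> b = 0"
proof -
  have a: "a = - (z * b)" using assms(3) by (simp add: add_eq_0_iff2)
  have "Im (a * cnj b) = - (Im z * (cmod b)\<^sup>2)"
    unfolding a cmod_power2 by (simp add: power2_eq_square algebra_simps)
  with assms(2) have "Im z * (cmod b)\<^sup>2 \<le> 0" by (simp add: below_def)
  with assms(1) have "b = 0" by (simp add: mult_le_0_iff)
  with a show ?thesis by simp
qed

text \<open>A term of largest rank is related by \<open>below\<close> to the sum of the others, so
  it can be peeled off. The ranking \<open>f\<close> need not be injective, which accommodates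
  repeated members.\<close>

lemma below_sum_eq_0:
  fixes f :: "'a \<Rightarrow> 'b :: linorder"
  assumes "finite S" "0 < Im z"
    and "\<And>i j. i \<in> S \<Longrightarrow> j \<in> S \<Longrightarrow> f i \<le> f j \<Longrightarrow> below z (a j) (a i)"
    and "(\<Sum>i\<in>S. a i) = 0"
  shows "\<forall>i\<in>S. a i = 0"
  using assms
proof (induction S rule: finite_ranking_induct[where f = f])
  case (insert x S)
  show ?case
  proof (cases "x \<in> S")
    case True
    then have "insert x S = S" by (rule insert_absorb)
    then show ?thesis using insert.IH insert.prems by simp
  next
    case False
    have "below z (a x) (\<Sum>i\<in>S. a i)"
      using insert.hyps insert.prems by (intro below_sum_right) simp
    moreover have "a x + (\<Sum>i\<in>S. a i) = 0"
      using insert.prems(3) insert.hyps(1) False by simp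
    ultimately have "a x = 0 \<and> (\<Sum>i\<in>S. a i) = 0"
      using below_add_eq_0 insert.prems(1) by blast
    moreover from this have "\<forall>i\<in>S. a i = 0"
      using insert.prems by (intro insert.IH) auto
    ultimately show ?thesis by simp
  qed
qed simp

text \<open>One step of the recursion: \<open>a\<close>, \<open>b\<close>, \<open>c\<close> stand
  for the sums over the letters below, between and above two thresholds.\<close>

lemma below_threshold:
  assumes "0 < Im z" "below z b a" "below z c a" "below z c b"
  shows "below z (a + b + z * c) (a + z * (b + c))"
proof -
  \<comment> \<open>The mixed terms of \<open>a\<close> and \<open>c\<close> cancel in the first
    expansion and are absorbed into a square in the second; all other terms are nonnegative.\<close>
  have "Im ((a + z * (b + c)) * cnj (a + b + z * c))
      = Im (z * b * cnj a) + Im (a * cnj b) + Im z * (cmod b)\<^sup>2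
        + Im (z * c * cnj b) + (cmod z)\<^sup>2 * Im (b * cnj c)"
    unfolding cmod_power2 times_complex.sel plus_complex.sel cnj.sel by algebra
  moreover have "Im (z * (a + b + z * c) * cnj (a + z * (b + c)))
      = Im z * (cmod (a + z * c))\<^sup>2 + Im (z * b * cnj a) + (cmod z)\<^sup>2 * Im (a * cnj b)
        + (cmod z)\<^sup>2 * Im (z * c * cnj b) + (cmod z)\<^sup>2 * Im (b * cnj c)"
    unfolding cmod_power2 times_complex.sel plus_complex.sel cnj.sel by algebra
  ultimately show ?thesis
    using assms unfolding below_def by simp
qed


section \<open>Interlacing from arguments\<close>

abbreviation cpoly :: "real poly \<Rightarrow> complex \<Rightarrow> complex" where
  "cpoly p z \<equiv> poly (map_poly complex_of_real p) z"

lemma map_poly_of_real_add: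
  "map_poly of_real (p + q) = map_poly of_real p + (map_poly of_real q :: 'a :: real_algebra_1 poly)"
  by (intro poly_eqI) (simp add: coeff_map_poly)

lemma map_poly_of_real_mult:
  "map_poly of_real (p * q) =
   map_poly of_real p * (map_poly of_real q :: 'a :: {comm_ring_1, real_algebra_1} poly)"
  by (intro poly_eqI) (simp add: coeff_map_poly coeff_mult)

lemma cpoly_add: "cpoly (p + q) z = cpoly p z + cpoly q z"
  by (simp add: map_poly_of_real_add)

lemma cpoly_sum: "cpoly (\<Sum>i\<in>S. p i) z = (\<Sum>i\<in>S. cpoly (p i) z)"
  by (induction S rule: infinite_finite_induct) (simp_all add: cpoly_add)

lemma cpoly_mult: "cpoly (p * q) z = cpoly p z * cpoly q z"
  by (simp add: map_poly_of_real_mult)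

lemma cpoly_of_real: "cpoly p (of_real a) = of_real (poly p a)"
  by (induction p) (simp_all add: map_poly_pCons)

text \<open>Roots come in conjugate pairs, so the upper half-plane suffices. Concluding
  \<open>p = 0\<close> from a zero there admits the zero polynomial, which does occur for some
  \<open>T\<close>.\<close>

lemma real_rootedI:
  assumes "\<And>z. 0 < Im z \<Longrightarrow> cpoly p z = 0 \<Longrightarrow> p = 0"
  shows "real_rooted p"
proof -
  have "z \<in> \<real>" if p: "p \<noteq> 0" and z: "cpoly p z = 0" for z
  proof -
    have "cnj (cpoly p z) = cpoly p (cnj z)"
      by (rule poly_cnj_real) (simp add: coeff_map_poly)
    with z have "cpoly p (cnj z) = 0" by simp
    with z p assms[of z] assms[of "cnj z"] have "Im z = 0"
      by (cases "Im z" "0 :: real" rule: linorder_cases) auto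
    then show ?thesis by (simp add: complex_is_Real_iff)
  qed
  then show ?thesis unfolding real_rooted_def by blast
qed

section \<open>Factorization of real-rooted polynomials and their arguments on horizontal
  lines\<close>

lemma real_rooted_factorization:
  assumes "p \<noteq> 0" "real_rooted p"
  shows "p = smult (lead_coeff p) (\<Prod>a\<in>#proots p. [:- a, 1:])"
  using assms
proof (induction "degree p" arbitrary: p)
  case 0
  then obtain c where "p = [:c:]" by (metis degree_eq_zeroE)
  then show ?case by simp
next
  case (Suc d)
  have "\<not> constant (poly (map_poly complex_of_real p))"
    using Suc.hyps(2) by (simp add: constant_degree degree_map_poly)
  \<comment> \<open>A complex root exists and is real by hypothesis, so its linear factor splits off
    over the reals.\<close>
  then obtain z where "cpoly p z = 0"
    using fundamental_theorem_of_algebra by blast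
  moreover from this have "z \<in> \<real>"
    using Suc.prems by (simp add: real_rooted_def)
  ultimately obtain a where "poly p a = 0"
    by (metis Reals_cases cpoly_of_real of_real_eq_0_iff)
  then obtain q where p: "p = [:- a, 1:] * q"
    by (metis poly_eq_0_iff_dvd dvdE)
  have q: "q \<noteq> 0" using Suc.prems(1) p by auto
  have "real_rooted q"
    using Suc.prems q unfolding p real_rooted_def by (simp add: cpoly_mult del: mult_pCons_left)
  moreover have "d = degree q"
    using Suc.hyps(2) q unfolding p by (subst (asm) degree_mult_eq) auto
  ultimately have "q = smult (lead_coeff q) (\<Prod>a\<in>#proots q. [:- a, 1:])"
    using Suc.hyps(1) q by blast
  moreover have "proots p = {#a#} + proots q"
    using q unfolding p by (subst proots_mult) auto
  moreover have "lead_coeff p = lead_coeff q"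
    unfolding p by (simp add: lead_coeff_mult del: mult_pCons_left)
  ultimately show ?case
    by (metis (no_types, lifting) image_mset_single image_mset_union mult_smult_right p
        prod_mset_Un prod_mset_singleton)
qed

text \<open>The summand is the argument in \<open>{0<..<pi}\<close> of \<open>Complex x y - a\<close> for \<open>y > 0\<close>.\<close>
definition angle_sum :: "real multiset \<Rightarrow> real \<Rightarrow> real \<Rightarrow> real" where
  "angle_sum A x y = (\<Sum>a\<in>#A. pi / 2 - arctan ((x - a) / y))"

lemma angle_sum_add_mset:
  "angle_sum (add_mset a A) x y = (pi / 2 - arctan ((x - a) / y)) + angle_sum A x y"
  by (simp add: angle_sum_def)

lemma Complex_polar_arctan:
  assumes "0 < y"
  shows "\<exists>R>0. Complex x y = of_real R * cis (pi / 2 - arctan (x / y))"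
proof (intro exI conjI)
  let ?s = "sqrt (1 + (x / y)\<^sup>2)"
  have "0 < ?s" by (simp add: add_pos_nonneg)
  with assms show "0 < y * ?s" by simp
  show "Complex x y = of_real (y * ?s) * cis (pi / 2 - arctan (x / y))"
    using assms \<open>0 < ?s\<close>
    by (simp add: complex_eq_iff cos_diff sin_diff cos_arctan sin_arctan)
qed

lemma prod_mset_polar:
  assumes "0 < y"
  shows "\<exists>R>0. (\<Prod>a\<in>#A. Complex x y - of_real a) = of_real R * cis (angle_sum A x y)"
proof (induction A)
  case empty
  show ?case by (rule exI[of _ 1]) (simp add: angle_sum_def)
next
  case (add a A)
  then obtain R where R: "0 < R"
    "(\<Prod>a\<in>#A. Complex x y - of_real a) = of_real R * cis (angle_sum A x y)" by blast
  obtain S where S: "0 < S"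
    "Complex (x - a) y = of_real S * cis (pi / 2 - arctan ((x - a) / y))"
    using Complex_polar_arctan[OF assms] by blast
  have "Complex x y - of_real a = Complex (x - a) y" by (simp add: complex_eq_iff)
  then have "(\<Prod>a\<in>#add_mset a A. Complex x y - of_real a) =
      of_real S * cis (pi / 2 - arctan ((x - a) / y)) * (of_real R * cis (angle_sum A x y))"
    unfolding R(2)[symmetric] S(2)[symmetric] by simp
  also have "\<dots> = of_real (S * R) * cis (angle_sum (add_mset a A) x y)"
    by (simp only: angle_sum_add_mset cis_mult[symmetric] of_real_mult ac_simps)
  finally have "(\<Prod>a\<in>#add_mset a A. Complex x y - of_real a) =
      of_real (S * R) * cis (angle_sum (add_mset a A) x y)" .
  with R S show ?case by (metis mult_pos_pos)
qed

text \<open>A positive leading coefficient contributes no argument, so \<open>angle_sum\<close> is a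
  branch of the argument that is continuous along the line.\<close>

lemma cpoly_polar:
  assumes "real_rooted p" "0 < lead_coeff p" "0 < y"
  shows "\<exists>R>0. cpoly p (Complex x y) = of_real R * cis (angle_sum (proots p) x y)"
proof -
  obtain R where R: "0 < R"
    "(\<Prod>a\<in>#proots p. Complex x y - of_real a) = of_real R * cis (angle_sum (proots p) x y)"
    using prod_mset_polar[OF assms(3)] by blast
  have prod: "cpoly (\<Prod>a\<in>#A. [:- a, 1:]) z = (\<Prod>a\<in>#A. z - of_real a)" for A z
    by (induction A) (simp_all add: cpoly_mult map_poly_pCons del: mult_pCons_left)
  have smult: "cpoly (smult c q) z = of_real c * cpoly q z" for c q z
    using cpoly_mult[of "[:c:]" q z] by (simp add: map_poly_pCons)
  have p: "p = smult (lead_coeff p) (\<Prod>a\<in>#proots p. [:- a, 1:])"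
    using assms by (intro real_rooted_factorization) auto
  have "cpoly p (Complex x y)
      = of_real (lead_coeff p) * (\<Prod>a\<in>#proots p. Complex x y - of_real a)"
    by (subst (1) p) (simp only: smult prod)
  then have "cpoly p (Complex x y) = of_real (lead_coeff p * R) * cis (angle_sum (proots p) x y)"
    using R by simp
  with R assms show ?thesis by (metis mult_pos_pos)
qed

lemma isCont_angle_sum: "y \<noteq> 0 \<Longrightarrow> isCont (\<lambda>x. angle_sum A x y) x"
  unfolding angle_sum_def by (induction A) (auto intro!: continuous_intros)

lemma tendsto_angle_sum_at_top:
  assumes "0 < y"
  shows "((\<lambda>x. angle_sum A x y) \<longlongrightarrow> 0) at_top"
proof (induction A)
  case (add a A)
  have "filterlim (\<lambda>x. (x - a) / y) at_top at_top"
    using assms by real_asymp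
  then have "((\<lambda>x. arctan ((x - a) / y)) \<longlongrightarrow> pi / 2) at_top"
    by (rule filterlim_compose[OF tendsto_arctan_at_top])
  then have "((\<lambda>x. (pi / 2 - arctan ((x - a) / y)) + angle_sum A x y) \<longlongrightarrow> (pi / 2 - pi / 2) + 0) at_top"
    using add by (intro tendsto_intros)
  then show ?case by (simp add: angle_sum_add_mset)
qed (simp add: angle_sum_def)

text \<open>Near the real axis a root to the right of \<open>t\<close> contributes an angle near pi,
  one to the left an angle near 0. A root at \<open>t\<close> itself would contribute pi/2.\<close>

lemma tendsto_angle_sum_at_right_0:
  assumes "t \<notin># A"
  shows "((\<lambda>y. angle_sum A t y) \<longlongrightarrow> pi * size {#a \<in># A. t < a#}) (at_right 0)"
  using assms
proof (induction A)
  case (add a A)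
  let ?l = "if t < a then pi else 0"
  have "((\<lambda>y. pi / 2 - arctan ((t - a) / y)) \<longlongrightarrow> ?l) (at_right 0)"
  proof (cases "t < a")
    case True
    then have "filterlim (\<lambda>y. (t - a) / y) at_bot (at_right 0)" by real_asymp
    then have "((\<lambda>y. arctan ((t - a) / y)) \<longlongrightarrow> - (pi / 2)) (at_right 0)"
      by (rule filterlim_compose[OF tendsto_arctan_at_bot])
    from tendsto_diff[OF tendsto_const this, of "pi / 2"] True show ?thesis by simp
  next
    case False
    with add.prems have "a < t" by auto
    then have "filterlim (\<lambda>y. (t - a) / y) at_top (at_right 0)" by real_asymp
    then have "((\<lambda>y. arctan ((t - a) / y)) \<longlongrightarrow> pi / 2) (at_right 0)"
      by (rule filterlim_compose[OF tendsto_arctan_at_top])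
    from tendsto_diff[OF tendsto_const this, of "pi / 2"] False show ?thesis by simp
  qed
  moreover have "((\<lambda>y. angle_sum A t y) \<longlongrightarrow> pi * size {#a \<in># A. t < a#}) (at_right 0)"
    using add by simp
  ultimately have "((\<lambda>y. (pi / 2 - arctan ((t - a) / y)) + angle_sum A t y)
      \<longlongrightarrow> ?l + pi * size {#a \<in># A. t < a#}) (at_right 0)"
    by (rule tendsto_add)
  then show ?case by (simp add: angle_sum_add_mset algebra_simps split: if_splits)
next
  case empty
  show ?case unfolding angle_sum_def by simp
qed

text \<open>By the intermediate value theorem \<open>h\<close> cannot leave \<open>{0..pi}\<close> without entering a region where
  the sine is negative.\<close>
lemma angle_bounds:
  fixes h :: "real \<Rightarrow> real"
  assumes cont: "\<And>x. isCont h x" and lim: "(h \<longlongrightarrow> 0) at_top" and sin: "\<And>x. 0 \<le> sin (h x)"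
  shows "0 \<le> h x \<and> h x \<le> pi"
proof (rule ccontr)
  assume outside: "\<not> (0 \<le> h x \<and> h x \<le> pi)"
  \<comment> \<open>The value \<open>v\<close> lies beyond the violated bound but no further than
    \<open>h x\<close>, and is clamped to where the sine is negative.\<close>
  define v where "v = (if h x < 0 then max (h x) (- pi / 2) else min (h x) (3 * pi / 2))"
  have v: "h x < 0 \<and> h x \<le> v \<and> - pi / 2 \<le> v \<and> v < 0 \<or>
      pi < h x \<and> v \<le> h x \<and> pi < v \<and> v \<le> 3 * pi / 2"
    using outside pi_gt_zero by (auto simp: v_def)
  have "\<forall>\<^sub>F u in at_top. dist (h u) 0 < \<bar>v\<bar>"
    using v pi_gt_zero by (intro tendstoD[OF lim]) auto
  then have "\<forall>\<^sub>F u in at_top. x \<le> u \<and> \<bar>h u\<bar> < \<bar>v\<bar>"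
    using eventually_ge_at_top by eventually_elim simp
  then obtain u where u: "x \<le> u" "\<bar>h u\<bar> < \<bar>v\<bar>"
    using eventually_happens'[OF trivial_limit_at_top_linorder] by blast
  obtain s where s: "h s = v"
    using v
  proof
    assume "h x < 0 \<and> h x \<le> v \<and> - pi / 2 \<le> v \<and> v < 0"
    with u have "h x \<le> v" "v \<le> h u" by auto
    with u(1) cont IVT[of h x v u] that show ?thesis by blast
  next
    assume "pi < h x \<and> v \<le> h x \<and> pi < v \<and> v \<le> 3 * pi / 2"
    with u have "v \<le> h x" "h u \<le> v" using pi_gt_zero by auto
    with u(1) cont IVT2[of h u v x] that show ?thesis by blast
  qed
  from v have "sin v < 0"
  proof
    assume "h x < 0 \<and> h x \<le> v \<and> - pi / 2 \<le> v \<and> v < 0"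
    then show ?thesis using sin_gt_zero[of "- v"] pi_gt_zero by simp
  next
    assume "pi < h x \<and> v \<le> h x \<and> pi < v \<and> v \<le> 3 * pi / 2"
    then show ?thesis using sin_lt_zero[of v] pi_gt_zero by simp
  qed
  with sin[of s] s show False by simp
qed

text \<open>The difference of the angle sums is the branch of the argument of \<open>g / f\<close>
  that tends to 0 far to the right, so \<open>angle_bounds\<close> confines it to
  \<open>{0..pi}\<close>. Its limit at the real axis is pi times the difference of the root
  counts.\<close>

lemma root_count_bounds:
  assumes f: "real_rooted f" "0 < lead_coeff f" and g: "real_rooted g" "0 < lead_coeff g"
    and fg: "\<And>z. 0 < Im z \<Longrightarrow> 0 \<le> Im (cpoly g z * cnj (cpoly f z))"
    and t: "t \<notin># proots f" "t \<notin># proots g"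
  shows "size {#a \<in># proots f. t < a#} \<le> size {#a \<in># proots g. t < a#}"
    and "size {#a \<in># proots g. t < a#} \<le> Suc (size {#a \<in># proots f. t < a#})"
proof -
  let ?A = "proots f" and ?B = "proots g"
  have bounds: "0 \<le> angle_sum ?B x y - angle_sum ?A x y \<and> angle_sum ?B x y - angle_sum ?A x y \<le> pi"
    if y: "0 < y" for x y
  proof (rule angle_bounds[where h = "\<lambda>x. angle_sum ?B x y - angle_sum ?A x y" and x = x])
    show "isCont (\<lambda>x. angle_sum ?B x y - angle_sum ?A x y) x" for x
      using y by (intro continuous_intros isCont_angle_sum) auto
    show "((\<lambda>x. angle_sum ?B x y - angle_sum ?A x y) \<longlongrightarrow> 0) at_top"
      using tendsto_diff[OF tendsto_angle_sum_at_top tendsto_angle_sum_at_top] y by fastforce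
    show "0 \<le> sin (angle_sum ?B x y - angle_sum ?A x y)" for x
    proof -
      obtain R where R: "0 < R" "cpoly f (Complex x y) = of_real R * cis (angle_sum ?A x y)"
        using cpoly_polar[OF f y] by blast
      obtain S where S: "0 < S" "cpoly g (Complex x y) = of_real S * cis (angle_sum ?B x y)"
        using cpoly_polar[OF g y] by blast
      have "0 \<le> Im (cpoly g (Complex x y) * cnj (cpoly f (Complex x y)))"
        using fg y by simp
      also have "\<dots> = (S * R) * sin (angle_sum ?B x y - angle_sum ?A x y)"
        unfolding R S by (simp add: sin_diff algebra_simps)
      finally show ?thesis using mult_pos_pos[OF S(1) R(1)] by (simp add: zero_le_mult_iff)
    qed
  qed
  let ?a = "size {#a \<in># ?A. t < a#}" and ?b = "size {#a \<in># ?B. t < a#}"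
  have lim: "((\<lambda>y. angle_sum ?B t y - angle_sum ?A t y) \<longlongrightarrow> pi * ?b - pi * ?a) (at_right 0)"
    using t by (intro tendsto_diff tendsto_angle_sum_at_right_0)
  have pos: "\<forall>\<^sub>F y::real in at_right 0. 0 < y"
    by (simp add: eventually_at_right_less)
  have "0 \<le> pi * ?b - pi * ?a"
    using bounds pos by (intro tendsto_lowerbound[OF lim]) (auto elim: eventually_mono)
  then have "pi * ?a \<le> pi * ?b" by simp
  then show "?a \<le> ?b" by simp
  have "pi * ?b - pi * ?a \<le> pi"
    using bounds pos by (intro tendsto_upperbound[OF lim]) (auto elim: eventually_mono)
  then have "pi * real ?b \<le> pi * real (Suc ?a)" by (simp add: algebra_simps)
  then show "?b \<le> Suc ?a" by (subst (asm) mult_le_cancel_left_pos) auto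
qed

section \<open>Sorted root lists, root counts and the return to interlacing\<close>

lemma mset_roots_desc [simp]: "mset (roots_desc p) = proots p"
  by (simp add: roots_desc_def)

lemma roots_desc_antimono:
  "i \<le> j \<Longrightarrow> j < length (roots_desc p) \<Longrightarrow> roots_desc p ! j \<le> roots_desc p ! i"
  using sorted_rev_nth_mono[of "roots_desc p" i j] by (simp add: roots_desc_def)

lemma size_filter_mset_nth:
  "size {#a \<in># mset xs. P a#} = card {i. i < length xs \<and> P (xs ! i)}"
  by (simp add: length_filter_conv_card flip: mset_filter)

text \<open>In a weakly decreasing list the entries above \<open>t\<close> form an initial
  segment.\<close>

lemma roots_desc_gt_iff:
  assumes "i < length (roots_desc p)"
  shows "t < roots_desc p ! i \<longleftrightarrow> i < size {#a \<in># proots p. t < a#}"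
proof -
  let ?x = "roots_desc p"
  let ?I = "{i. i < length ?x \<and> t < ?x ! i}"
  have card: "size {#a \<in># proots p. t < a#} = card ?I"
    using size_filter_mset_nth[of "(<) t" ?x] by simp
  show ?thesis
  proof
    assume "t < ?x ! i"
    then have "{..i} \<subseteq> ?I"
      using assms by (force dest: roots_desc_antimono)
    from card_mono[OF _ this] show "i < size {#a \<in># proots p. t < a#}" by (simp add: card)
  next
    assume less: "i < size {#a \<in># proots p. t < a#}"
    show "t < ?x ! i"
    proof (rule ccontr)
      assume "\<not> t < ?x ! i"
      then have "?I \<subseteq> {..<i}"
        by (auto simp: not_less) (meson leI order_trans roots_desc_antimono not_le)
      from card_mono[OF _ this] less show False by (simp add: card)
    qed
  qed
qed

text \<open>A violated inequality of the chain leaves a gap containing a non-root \<open>t\<close>,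
  where the counts contradict \<open>root_count_bounds\<close>.\<close>

lemma interlacesI:
  assumes f: "real_rooted f" "0 < lead_coeff f" and g: "real_rooted g" "0 < lead_coeff g"
    and fg: "\<And>z. 0 < Im z \<Longrightarrow> 0 \<le> Im (cpoly g z * cnj (cpoly f z))"
  shows "interlaces f g"
proof -
  let ?\<alpha> = "roots_desc f" and ?\<beta> = "roots_desc g"
  let ?F = "set_mset (proots f + proots g)"
  let ?N = "\<lambda>p t. size {#a \<in># proots p. t < a#}"
  have N: "?N f t \<le> ?N g t" "?N g t \<le> Suc (?N f t)" if "t \<notin> ?F" for t
    using root_count_bounds[OF f g fg] that by auto
  have between: "\<exists>t. t \<notin> ?F \<and> u < t \<and> t < v" if "u < v" for u v :: real
  proof -
    have "infinite ({u<..<v} - ?F)"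
      using that by (intro Diff_infinite_finite) (auto simp: infinite_Ioo)
    then obtain t where "t \<in> {u<..<v} - ?F" by (metis all_not_in_conv finite.emptyI)
    then show ?thesis by auto
  qed
  have size: "length (roots_desc p) = size (proots p)" for p
    by (metis mset_roots_desc size_mset)
  \<comment> \<open>To the left of all roots the counts are the full numbers of roots. Inserting 0
    keeps \<open>Min\<close> meaningful when there are no roots.\<close>
  obtain t where t: "\<forall>a\<in>?F. t < a"
  proof
    show "\<forall>a\<in>?F. Min (insert 0 ?F) - 1 < a"
      by (auto simp: less_le_trans minus_less_iff diff_less_eq add.commute
          intro!: le_less_trans[OF Min_le less_add_one])
  qed
  then have "t \<notin> ?F" by blast
  moreover have "{#a \<in># proots f. t < a#} = proots f" "{#a \<in># proots g. t < a#} = proots g"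
    using t by (auto intro!: filter_mset_eq_conv[THEN iffD2])
  ultimately have "length ?\<alpha> \<le> length ?\<beta>" "length ?\<beta> \<le> length ?\<alpha> + 1"
    using N[of t] by (simp_all add: size)
  moreover have "?\<alpha> ! i \<le> ?\<beta> ! i" if i: "i < length ?\<alpha>" for i
  proof (rule ccontr)
    assume "\<not> ?thesis"
    then obtain t where t: "t \<notin> ?F" "?\<beta> ! i < t" "t < ?\<alpha> ! i"
      using between not_le by metis
    have "i < ?N f t" using t i by (simp flip: roots_desc_gt_iff)
    also have "\<dots> \<le> ?N g t" using N t by blast
    finally have "t < ?\<beta> ! i"
      using i \<open>length ?\<alpha> \<le> length ?\<beta>\<close> by (simp add: roots_desc_gt_iff)
    with t show False by simp
  qed
  moreover have "?\<beta> ! (i + 1) \<le> ?\<alpha> ! i" if i: "i < length ?\<alpha>" "i + 1 < length ?\<beta>" for i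
  proof (rule ccontr)
    assume "\<not> ?thesis"
    then obtain t where t: "t \<notin> ?F" "?\<alpha> ! i < t" "t < ?\<beta> ! (i + 1)"
      using between not_le by metis
    have "i + 1 < ?N g t" using t i roots_desc_gt_iff[OF i(2)] by blast
    also have "\<dots> \<le> Suc (?N f t)" using N t by blast
    finally have "t < ?\<alpha> ! i"
      using i by (simp add: roots_desc_gt_iff)
    with t show False by simp
  qed
  ultimately show ?thesis
    using f g unfolding interlaces_def Let_def by blast
qed


section \<open>Permutations with prescribed last letter\<close>

lemma inj_on_imp_permutes:
  assumes "finite S" "inj_on f S" "f ` S \<subseteq> S" "\<And>x. x \<notin> S \<Longrightarrow> f x = x"
  shows "f permutes S"
  using assms by (intro bij_imp_permutes) (auto simp: bij_betw_def endo_inj_surj)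

definition eulerian_last :: "nat set \<Rightarrow> nat \<Rightarrow> nat \<Rightarrow> real poly" where
  "eulerian_last T m k =
     (\<Sum>v | v permutes {1..m} \<and> Des m v \<subseteq> T \<and> v m = k. monom 1 (des m v))"

text \<open>The common source of three identities: \<open>\<rho>\<close> will be the identity, the
  shift that makes room for a last letter, and the standardization of a colouring.\<close>

lemma eulerian_last_compose:
  assumes \<rho>: "\<rho> permutes {1..Suc m}"
  shows "eulerian_last T (Suc m) (\<rho> (Suc m)) =
    (\<Sum>w | w permutes {1..m} \<and> Des (Suc m) (\<rho> \<circ> w) \<subseteq> T. monom 1 (des (Suc m) (\<rho> \<circ> w)))"
  unfolding eulerian_last_def
proof (rule sum.reindex_bij_witness[where i = "\<lambda>w. \<rho> \<circ> w" and j = "\<lambda>v. inv \<rho> \<circ> v"])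
  note inverses = permutes_inverses[OF \<rho>]
  fix v assume v: "v \<in> {v. v permutes {1..Suc m} \<and> Des (Suc m) v \<subseteq> T \<and> v (Suc m) = \<rho> (Suc m)}"
  show eq: "\<rho> \<circ> (inv \<rho> \<circ> v) = v" using inverses by auto
  have "inv \<rho> \<circ> v permutes {1..Suc m}"
    using v \<rho> by (auto intro: permutes_compose permutes_inv)
  moreover have "(inv \<rho> \<circ> v) x = x" if "x \<in> {1..Suc m} - {1..m}" for x
  proof -
    from that have "x = Suc m" by auto
    with v inverses show ?thesis by simp
  qed
  ultimately have "inv \<rho> \<circ> v permutes {1..m}" by (rule permutes_superset)
  with v eq show "inv \<rho> \<circ> v \<in> {w. w permutes {1..m} \<and> Des (Suc m) (\<rho> \<circ> w) \<subseteq> T}" by simp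
  show "monom 1 (des (Suc m) (\<rho> \<circ> (inv \<rho> \<circ> v))) = (monom 1 (des (Suc m) v) :: real poly)"
    by (simp only: eq)
next
  fix w assume w: "w \<in> {w. w permutes {1..m} \<and> Des (Suc m) (\<rho> \<circ> w) \<subseteq> T}"
  then have "w permutes {1..Suc m}" by (auto intro: permutes_subset)
  moreover have "w (Suc m) = Suc m" using w by (auto intro: permutes_not_in)
  ultimately show "\<rho> \<circ> w \<in> {v. v permutes {1..Suc m} \<and> Des (Suc m) v \<subseteq> T \<and> v (Suc m) = \<rho> (Suc m)}"
    using w \<rho> by (auto intro: permutes_compose)
  show "inv \<rho> \<circ> (\<rho> \<circ> w) = w" using permutes_inverses[OF \<rho>] by auto
qed

lemma Des_Suc: "Des (Suc m) v = {i \<in> {1..m}. v (Suc i) < v i}"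
  by (simp add: Des_def)

lemma Des_Suc_insert:
  assumes "1 \<le> m"
  shows "Des (Suc m) v = (if v (Suc m) < v m then insert m (Des m v) else Des m v)"
proof -
  have "{1..m} = insert m {1..m - 1}" using assms by auto
  then show ?thesis by (auto simp: Des_def)
qed

lemma not_in_Des: "1 \<le> m \<Longrightarrow> m \<notin> Des m v"
  by (auto simp: Des_def)

lemma finite_Des [simp]: "finite (Des m v)"
  by (simp add: Des_def)

text \<open>The appended letter \<open>Suc n\<close> exceeds all others and creates no
  descent.\<close>

lemma eulerian_eq_eulerian_last:
  assumes "0 < n"
  shows "eulerian T n = eulerian_last T (Suc n) (Suc n)"
proof -
  have "Des (Suc n) w = Des n w" if "w permutes {1..n}" for w
  proof -
    have "w (Suc n) = Suc n" using that by (auto intro: permutes_not_in)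
    moreover have "w n \<le> n" using permutes_in_image[OF that, of n] assms by auto
    ultimately show ?thesis using assms by (simp add: Des_Suc_insert)
  qed
  then show ?thesis
    using eulerian_last_compose[OF permutes_id, of T n]
    by (auto simp: eulerian_def des_def intro!: sum.cong)
qed

lemma shift_permutes:
  assumes "1 \<le> k" "k \<le> Suc m"
  shows "(\<lambda>j. if j < k \<or> Suc m < j then j else if j = Suc m then k else Suc j) permutes {1..Suc m}"
  using assms by (intro inj_on_imp_permutes) (auto simp: inj_on_def split: if_splits)

text \<open>Delete the last letter \<open>k\<close> and close the gap. If \<open>j\<close> is then
  last, position \<open>m\<close> was a descent exactly when \<open>j \<ge> k\<close>, since such a
  \<open>j\<close> had been \<open>j + 1\<close>. This descent requires \<open>m \<in> T\<close> and
  contributes a factor x.\<close>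

lemma eulerian_last_Suc:
  assumes m: "1 \<le> m" and k: "1 \<le> k" "k \<le> Suc m"
  shows "eulerian_last T (Suc m) k = (\<Sum>j=1..<k. eulerian_last T m j)
    + (if m \<in> T then [:0, 1:] * (\<Sum>j=k..m. eulerian_last T m j) else 0)"
proof -
  \<comment> \<open>Composing with \<open>\<rho>\<close> appends the last letter \<open>k\<close> to a permutation of \<open>{1..m}\<close>.\<close>
  define \<rho> where "\<rho> = (\<lambda>j. if j < k \<or> Suc m < j then j else if j = Suc m then k else Suc j)"
  have \<rho>: "\<rho> permutes {1..Suc m}" unfolding \<rho>_def by (rule shift_permutes[OF k])
  have [simp]: "\<rho> (Suc m) = k" using k by (simp add: \<rho>_def)
  have Des: "Des (Suc m) (\<rho> \<circ> w) = (if w m < k then Des m w else insert m (Des m w))"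
    if w: "w permutes {1..m}" for w
  proof -
    have in_image: "w i \<in> {1..m}" if "i \<in> {1..m}" for i
      using that w by (simp only: permutes_in_image)
    have mono: "\<rho> a < \<rho> b \<longleftrightarrow> a < b" if "a \<in> {1..m}" "b \<in> {1..m}" for a b
      using that by (auto simp: \<rho>_def)
    have "Des m (\<rho> \<circ> w) = Des m w"
      using in_image by (auto simp: Des_def mono)
    moreover have "w (Suc m) = Suc m" using w by (auto intro: permutes_not_in)
    moreover have "k < \<rho> (w m) \<longleftrightarrow> k \<le> w m"
      using in_image[of m] m by (auto simp: \<rho>_def)
    ultimately show ?thesis using m by (auto simp: Des_Suc_insert)
  qed
  let ?W = "\<lambda>j. {w. w permutes {1..m} \<and> Des (Suc m) (\<rho> \<circ> w) \<subseteq> T \<and> w m = j}"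
  let ?s = "\<lambda>j. \<Sum>w\<in>?W j. monom 1 (des (Suc m) (\<rho> \<circ> w)) :: real poly"
  have "eulerian_last T (Suc m) k =
      (\<Sum>w | w permutes {1..m} \<and> Des (Suc m) (\<rho> \<circ> w) \<subseteq> T. monom 1 (des (Suc m) (\<rho> \<circ> w)))"
    using eulerian_last_compose[OF \<rho>, of T] by simp
  also have "\<dots> = (\<Sum>j=1..m. ?s j)"
  proof (subst sum.group[symmetric, where g = "\<lambda>w. w m" and T = "{1..m}"])
    show "finite {w. w permutes {1..m} \<and> Des (Suc m) (\<rho> \<circ> w) \<subseteq> T}"
      by (rule finite_subset[OF _ finite_permutations[of "{1..m}"]]) auto
    show "(\<lambda>w. w m) ` {w. w permutes {1..m} \<and> Des (Suc m) (\<rho> \<circ> w) \<subseteq> T} \<subseteq> {1..m}"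
      using m permutes_in_image by fastforce
  qed (auto intro!: sum.cong)
  also have "\<dots> = (\<Sum>j=1..<k. ?s j) + (\<Sum>j=k..m. ?s j)"
  proof -
    have "{1..m} = {1..<k} \<union> {k..m}" using k by auto
    then show ?thesis by (simp only:) (rule sum.union_disjoint, auto)
  qed
  also have "(\<Sum>j=1..<k. ?s j) = (\<Sum>j=1..<k. eulerian_last T m j)"
  proof (rule sum.cong)
    fix j assume "j \<in> {1..<k}"
    then show "?s j = eulerian_last T m j"
      unfolding eulerian_last_def by (intro sum.cong) (auto simp: Des des_def)
  qed simp
  also have "(\<Sum>j=k..m. ?s j) = (if m \<in> T then [:0, 1:] * (\<Sum>j=k..m. eulerian_last T m j) else 0)"
  proof (cases "m \<in> T")
    case True
    have "?s j = [:0, 1:] * eulerian_last T m j" if "j \<in> {k..m}" for j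
      unfolding eulerian_last_def sum_distrib_left using that True m
      by (intro sum.cong) (auto simp: Des des_def not_in_Des monom_Suc)
    then show ?thesis using True by (simp add: sum_distrib_left)
  next
    case False
    then have "(\<Sum>j=k..m. ?s j) = 0"
      by (intro sum.neutral ballI) (auto simp: Des)
    then show ?thesis using False by simp
  qed
  finally show ?thesis .
qed

lemma eulerian_last_1: "eulerian_last T 1 1 = 1"
proof -
  have "{v. v permutes {1..1::nat} \<and> Des 1 v \<subseteq> T \<and> v 1 = 1} = {id}"
    by (auto simp: Des_def)
  then show ?thesis by (simp add: eulerian_last_def des_def Des_def)
qed

section \<open>Interlacing of the polynomials with prescribed last letter\<close>

lemma below_eulerian_last:
  assumes z: "0 < Im z" and "1 \<le> m" "1 \<le> i" "i \<le> j" "j \<le> m"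
  shows "below z (cpoly (eulerian_last T m j) z) (cpoly (eulerian_last T m i) z)"
  using assms(2-)
proof (induction m arbitrary: i j rule: nat_induct_at_least)
  case base
  then have "i = 1" "j = 1" by auto
  then show ?case using below_refl[OF z] by simp
next
  case (Suc m)
  let ?p = "\<lambda>j. cpoly (eulerian_last T m j) z"
  \<comment> \<open>Splitting the letters at \<open>i\<close> and \<open>j\<close> brings the
    recursion into the form of \<open>below_threshold\<close>.\<close>
  define a b c where "a = (\<Sum>l=1..<i. ?p l)" and "b = (\<Sum>l=i..<j. ?p l)" and "c = (\<Sum>l=j..m. ?p l)"
  have ba: "below z b a" and ca: "below z c a" and cb: "below z c b"
    unfolding a_def b_def c_def using Suc by (auto intro!: below_sums)
  have "{1..<j} = {1..<i} \<union> {i..<j}" and "{i..m} = {i..<j} \<union> {j..m}"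
    using Suc.prems by auto
  then have "(\<Sum>l=1..<j. ?p l) = a + b" "(\<Sum>l=i..m. ?p l) = b + c"
    unfolding a_def b_def c_def by (auto intro: sum.union_disjoint)
  then have "cpoly (eulerian_last T (Suc m) j) z = a + b + (if m \<in> T then z * c else 0)"
    "cpoly (eulerian_last T (Suc m) i) z = a + (if m \<in> T then z * (b + c) else 0)"
    using Suc.hyps Suc.prems
    by (simp_all add: eulerian_last_Suc cpoly_add cpoly_sum cpoly_mult map_poly_pCons a_def c_def
        del: mult_pCons_left)
  then show ?case
    using below_threshold[OF z ba ca cb] below_add_left[OF below_refl[OF z] ba] by simp
qed

text \<open>A zero in the upper half-plane descends through the recursion: \<open>below\<close>
  makes both partial sums vanish there, then each of their terms, which are zero polynomials by
  induction.\<close>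

lemma eulerian_last_eq_0:
  assumes z: "0 < Im z" and "1 \<le> m" "1 \<le> k" "k \<le> m" "cpoly (eulerian_last T m k) z = 0"
  shows "eulerian_last T m k = 0"
  using assms(2-)
proof (induction m arbitrary: k rule: nat_induct_at_least)
  case base
  then show ?case using eulerian_last_1[of T] by simp
next
  case (Suc m)
  let ?p = "\<lambda>j. cpoly (eulerian_last T m j) z"
  have sum_0: "(\<Sum>j\<in>S. eulerian_last T m j) = 0" if S: "S \<subseteq> {1..m}" "(\<Sum>j\<in>S. ?p j) = 0" for S
  proof -
    have "\<forall>j\<in>S. ?p j = 0"
    proof (rule below_sum_eq_0[where f = id, OF _ z _ S(2)])
      show "finite S" using S(1) by (rule finite_subset) simp
      show "below z (?p j) (?p i)" if "i \<in> S" "j \<in> S" "id i \<le> id j" for i j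
        using that S(1) Suc.hyps by (intro below_eulerian_last[OF z]) (auto dest: subsetD)
    qed
    then show ?thesis using S(1) Suc.IH by (intro sum.neutral) auto
  qed
  define a b where "a = (\<Sum>j=1..<k. ?p j)" and "b = (\<Sum>j=k..m. ?p j)"
  have eq: "a + (if m \<in> T then z * b else 0) = 0"
    using Suc.prems Suc.hyps
    by (simp add: eulerian_last_Suc cpoly_add cpoly_sum cpoly_mult map_poly_pCons a_def b_def
        del: mult_pCons_left split: if_splits)
  have "below z b a"
    unfolding a_def b_def using Suc.prems below_eulerian_last[OF z] by (auto intro!: below_sums)
  then have "a = 0 \<and> (m \<in> T \<longrightarrow> b = 0)"
    using eq below_add_times_eq_0[OF z] by (auto split: if_splits)
  moreover have "{1..<k} \<subseteq> {1..m}" "{k..m} \<subseteq> {1..m}"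
    using Suc.prems by auto
  ultimately have "(\<Sum>j=1..<k. eulerian_last T m j) = 0" "m \<in> T \<longrightarrow> (\<Sum>j=k..m. eulerian_last T m j) = 0"
    using sum_0[of "{1..<k}"] sum_0[of "{k..m}"]
    unfolding a_def b_def by blast+
  then show ?case using Suc.prems Suc.hyps by (simp add: eulerian_last_Suc)
qed


section \<open>Standardization of coloured permutations\<close>

text \<open>Here \<open>c j\<close> is the colour of the letter \<open>j\<close>, so that the colour vector of \<open>w\<close> is \<open>c \<circ> w\<close>.\<close>
definition colorings :: "nat \<Rightarrow> nat \<Rightarrow> (nat \<Rightarrow> nat) set" where
  "colorings n r = {c. (\<forall>i\<in>{1..n}. c i < r) \<and> (\<forall>i. i \<notin> {1..n} \<longrightarrow> c i = 0)}"

lemma finite_colorings: "finite (colorings n r)"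
proof -
  have "colorings n r = {c. \<forall>i. (i \<in> {1..n} \<longrightarrow> c i \<in> {..<r}) \<and> (i \<notin> {1..n} \<longrightarrow> c i = 0)}"
    by (auto simp: colorings_def)
  then show ?thesis using finite_set_of_finite_funs[of "{1..n}" "{..<r}" 0] by simp
qed

lemma colorings_comp:
  assumes "w permutes {1..n}" "c \<in> colorings n r"
  shows "c \<circ> w \<in> colorings n r"
  using assms permutes_in_image[OF assms(1)] by (auto simp: colorings_def)

lemma exists_standardization:
  fixes c :: "nat \<Rightarrow> 'a :: linorder"
  shows "\<exists>\<rho>. \<rho> permutes {1..m} \<and>
    (\<forall>a\<in>{1..m}. \<forall>b\<in>{1..m}. \<rho> a < \<rho> b \<longleftrightarrow> c a < c b \<or> c a = c b \<and> a < b)"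
proof -
  \<comment> \<open>The cardinality of \<open>D a\<close> is the rank of \<open>a\<close> by colour,
    then by letter; counting \<open>a\<close> itself makes ranks start at 1.\<close>
  define D where "D a = {i \<in> {1..m}. c i < c a \<or> c i = c a \<and> i \<le> a}" for a
  define \<rho> where "\<rho> a = (if a \<in> {1..m} then card (D a) else a)" for a
  have less: "\<rho> a < \<rho> b"
    if "a \<in> {1..m}" "b \<in> {1..m}" "c a < c b \<or> c a = c b \<and> a < b" for a b
  proof -
    have "b \<in> D b" "b \<notin> D a" "D a \<subseteq> D b" using that by (auto simp: D_def)
    then have "D a \<subset> D b" by blast
    moreover have "finite (D b)" by (simp add: D_def)
    ultimately show ?thesis using that by (simp add: \<rho>_def psubset_card_mono)
  qed
  then have iff: "\<rho> a < \<rho> b \<longleftrightarrow> c a < c b \<or> c a = c b \<and> a < b"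
    if "a \<in> {1..m}" "b \<in> {1..m}" for a b
    using that by (metis less_asym linorder_less_linear)
  have "\<rho> permutes {1..m}"
  proof (rule inj_on_imp_permutes)
    show "inj_on \<rho> {1..m}"
      by (rule inj_onI) (metis iff less_irrefl linorder_less_linear)
    show "\<rho> ` {1..m} \<subseteq> {1..m}"
    proof clarify
      fix a assume a: "a \<in> {1..m}"
      then have "a \<in> D a" "D a \<subseteq> {1..m}" by (auto simp: D_def)
      then have "1 \<le> card (D a)" "card (D a) \<le> m"
        using card_mono[of "{1..m}" "D a"] card_mono[of "D a" "{a}"] finite_subset[of "D a" "{1..m}"] by auto
      with a show "\<rho> a \<in> {1..m}" by (simp add: \<rho>_def)
    qed
  qed (auto simp: \<rho>_def)
  with iff show ?thesis by blast
qed

text \<open>A descent is a lexicographic decrease of colour and letter, hence a decrease of rank.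
  The boundary convention amounts to a final letter \<open>Suc n\<close> of colour 0.\<close>

lemma colored_Des_standardization:
  assumes w: "w permutes {1..n}" and c: "c (Suc n) = 0"
    and \<rho>: "\<And>a b. a \<in> {1..Suc n} \<Longrightarrow> b \<in> {1..Suc n} \<Longrightarrow> \<rho> a < \<rho> b \<longleftrightarrow> c a < c b \<or> c a = c b \<and> a < b"
  shows "colored_Des n (w, c \<circ> w) = Des (Suc n) (\<rho> \<circ> w)"
proof -
  have "w permutes {1..Suc n}" using w by (auto intro: permutes_subset)
  then have "w i \<in> {1..Suc n}" if "i \<in> {1..Suc n}" for i
    using that by (simp only: permutes_in_image)
  then have "\<rho> (w (Suc i)) < \<rho> (w i) \<longleftrightarrow>
      c (w (Suc i)) < c (w i) \<or> c (w (Suc i)) = c (w i) \<and> w (Suc i) < w i" if "i \<in> {1..n}" for i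
    using that by (intro \<rho>) auto
  then show ?thesis unfolding colored_Des_def Des_Suc by auto
qed

text \<open>Attaching colours to letters instead of positions makes the standardization independent
  of \<open>w\<close>.\<close>

lemma colored_eulerian_eq_sum_colorings:
  "colored_eulerian T n r = (\<Sum>c\<in>colorings n r.
     \<Sum>w | w permutes {1..n} \<and> colored_Des n (w, c \<circ> w) \<subseteq> T. monom 1 (colored_des n (w, c \<circ> w)))"
proof -
  let ?D = "\<lambda>c. {w. w permutes {1..n} \<and> colored_Des n (w, c \<circ> w) \<subseteq> T}"
  have "finite (?D c)" for c
    by (rule finite_subset[OF _ finite_permutations[of "{1..n}"]]) auto
  then have "(\<Sum>c\<in>colorings n r. \<Sum>w\<in>?D c. monom 1 (colored_des n (w, c \<circ> w))) =
      (\<Sum>(c, w)\<in>Sigma (colorings n r) ?D. monom (1::real) (colored_des n (w, c \<circ> w)))"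
    by (intro sum.Sigma) (auto simp: finite_colorings)
  also have "\<dots> = colored_eulerian T n r"
    unfolding colored_eulerian_def
  proof (rule sum.reindex_bij_witness[where
        i = "\<lambda>(w, z). (z \<circ> inv w, w)" and j = "\<lambda>(c, w). (w, c \<circ> w)"])
    fix u assume "u \<in> {u. u \<in> colored_perms n r \<and> colored_Des n u \<subseteq> T}"
    then obtain w z where u: "u = (w, z)" "w permutes {1..n}" "z \<in> colorings n r"
      "colored_Des n (w, z) \<subseteq> T"
      by (auto simp: colored_perms_def colorings_def)
    have comp: "z \<circ> inv w \<circ> w = z"
      using permutes_inverses[OF u(2)] by auto
    with u show "(case case u of (w, z) \<Rightarrow> (z \<circ> inv w, w) of (c, w) \<Rightarrow> (w, c \<circ> w)) = u" by simp
    show "(case u of (w, z) \<Rightarrow> (z \<circ> inv w, w)) \<in> Sigma (colorings n r) ?D"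
      using u comp colorings_comp[OF permutes_inv[OF u(2)] u(3)] by simp
  next
    fix p assume "p \<in> Sigma (colorings n r) ?D"
    then obtain c w where p: "p = (c, w)" "w permutes {1..n}" "c \<in> colorings n r"
      "colored_Des n (w, c \<circ> w) \<subseteq> T" by auto
    have comp: "c \<circ> w \<circ> inv w = c"
      using permutes_inverses[OF p(2)] by auto
    with p show "(case case p of (c, w) \<Rightarrow> (w, c \<circ> w) of (w, z) \<Rightarrow> (z \<circ> inv w, w)) = p" by simp
    show "(case p of (c, w) \<Rightarrow> (w, c \<circ> w)) \<in> {u. u \<in> colored_perms n r \<and> colored_Des n u \<subseteq> T}"
      using p colorings_comp[OF p(2,3)] by (simp add: colored_perms_def colorings_def)
    show "monom (1::real) (colored_des n (case p of (c, w) \<Rightarrow> (w, c \<circ> w))) =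
        (case p of (c, w) \<Rightarrow> monom 1 (colored_des n (w, c \<circ> w)))"
      using p by simp
  qed
  finally show ?thesis by simp
qed

text \<open>The witness \<open>\<kappa> c\<close> is the rank of the letter \<open>Suc n\<close>,
  which always stands last.\<close>

lemma colored_eulerian_eq_sum_eulerian_last:
  "\<exists>\<kappa>. (\<forall>c\<in>colorings n r. \<kappa> c \<in> {1..Suc n}) \<and>
     colored_eulerian T n r = (\<Sum>c\<in>colorings n r. eulerian_last T (Suc n) (\<kappa> c))"
proof -
  have "\<exists>k\<in>{1..Suc n}. (\<Sum>w | w permutes {1..n} \<and> colored_Des n (w, c \<circ> w) \<subseteq> T.
      monom 1 (colored_des n (w, c \<circ> w))) = eulerian_last T (Suc n) k"
    if c: "c \<in> colorings n r" for c
  proof -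
    obtain \<rho> where \<rho>: "\<rho> permutes {1..Suc n}"
      "\<And>a b. a \<in> {1..Suc n} \<Longrightarrow> b \<in> {1..Suc n} \<Longrightarrow> \<rho> a < \<rho> b \<longleftrightarrow> c a < c b \<or> c a = c b \<and> a < b"
      using exists_standardization[of "Suc n" c] by blast
    have "c (Suc n) = 0" using c by (simp add: colorings_def)
    then have Des: "colored_Des n (w, c \<circ> w) = Des (Suc n) (\<rho> \<circ> w)" if "w permutes {1..n}" for w
      using colored_Des_standardization[OF that] \<rho>(2) by blast
    show ?thesis
    proof
      show "\<rho> (Suc n) \<in> {1..Suc n}"
        using permutes_in_image[OF \<rho>(1), of "Suc n"] by simp
      show "(\<Sum>w | w permutes {1..n} \<and> colored_Des n (w, c \<circ> w) \<subseteq> T.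
          monom 1 (colored_des n (w, c \<circ> w))) = eulerian_last T (Suc n) (\<rho> (Suc n))"
        unfolding eulerian_last_compose[OF \<rho>(1)] colored_des_def des_def
        by (intro sum.cong) (auto simp: Des)
    qed
  qed
  then have "\<exists>\<kappa>. \<forall>c\<in>colorings n r. \<kappa> c \<in> {1..Suc n} \<and>
      (\<Sum>w | w permutes {1..n} \<and> colored_Des n (w, c \<circ> w) \<subseteq> T.
        monom 1 (colored_des n (w, c \<circ> w))) = eulerian_last T (Suc n) (\<kappa> c)"
    by (intro bchoice) blast
  then show ?thesis
    unfolding colored_eulerian_eq_sum_colorings by (elim exE, intro exI conjI sum.cong) auto
qed

lemma lead_coeff_sum_monom_pos:
  assumes "(\<Sum>i\<in>S. monom 1 (d i)) \<noteq> (0 :: real poly)"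
  shows "0 < lead_coeff (\<Sum>i\<in>S. monom 1 (d i) :: real poly)"
proof -
  have "0 \<le> lead_coeff (\<Sum>i\<in>S. monom 1 (d i) :: real poly)"
    by (simp add: coeff_sum sum_nonneg)
  with assms show ?thesis by (simp add: order.strict_iff_order)
qed

theorem theorem4p2:
  fixes n r :: nat and T :: "nat set"
  assumes "n > 0" and "r > 0" and "T \<subseteq> {1..n}"
  shows "real_rooted (colored_eulerian T n r)
         \<and> interlaces (eulerian T n) (colored_eulerian T n r)"
proof -
  let ?f = "eulerian T n" and ?g = "colored_eulerian T n r"
  obtain \<kappa> where \<kappa>: "\<And>c. c \<in> colorings n r \<Longrightarrow> \<kappa> c \<in> {1..Suc n}"
    and g: "?g = (\<Sum>c\<in>colorings n r. eulerian_last T (Suc n) (\<kappa> c))"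
    using colored_eulerian_eq_sum_eulerian_last by blast
  have f: "?f = eulerian_last T (Suc n) (Suc n)"
    using eulerian_eq_eulerian_last assms(1) .
  have "?g = 0" if z: "0 < Im z" "cpoly ?g z = 0" for z
  proof -
    \<comment> \<open>The summands are ranked by last letter, which several colourings may
      share.\<close>
    have "\<forall>c\<in>colorings n r. cpoly (eulerian_last T (Suc n) (\<kappa> c)) z = 0"
    proof (rule below_sum_eq_0[where f = \<kappa>, OF finite_colorings z(1)])
      show "below z (cpoly (eulerian_last T (Suc n) (\<kappa> d)) z) (cpoly (eulerian_last T (Suc n) (\<kappa> c)) z)"
        if "c \<in> colorings n r" "d \<in> colorings n r" "\<kappa> c \<le> \<kappa> d" for c d
        using that \<kappa> below_eulerian_last[OF z(1)] by auto
      show "(\<Sum>c\<in>colorings n r. cpoly (eulerian_last T (Suc n) (\<kappa> c)) z) = 0"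
        using z(2) by (simp add: g cpoly_sum)
    qed
    then show "?g = 0"
      unfolding g using \<kappa> eulerian_last_eq_0[OF z(1)] by (intro sum.neutral) auto
  qed
  then have real_rooted_g: "real_rooted ?g" by (rule real_rootedI)
  have real_rooted_f: "real_rooted ?f"
    unfolding f by (rule real_rootedI) (simp add: eulerian_last_eq_0)
  have "0 \<le> Im (cpoly ?g z * cnj (cpoly ?f z))" if z: "0 < Im z" for z
  proof -
    \<comment> \<open>The last letter \<open>Suc n\<close> of \<open>?f\<close> is the largest
      possible, so \<open>below\<close> relates \<open>?f\<close> to every summand of
      \<open>?g\<close>.\<close>
    have "below z (cpoly ?f z) (cpoly ?g z)"
      unfolding f g cpoly_sum using \<kappa> by (intro below_sum_right below_eulerian_last[OF z]) auto
    then show ?thesis by (simp add: below_def)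
  qed
  moreover have "0 < lead_coeff ?f" if "?f \<noteq> 0"
    using that unfolding eulerian_def by (rule lead_coeff_sum_monom_pos)
  moreover have "0 < lead_coeff ?g" if "?g \<noteq> 0"
    using that unfolding colored_eulerian_def by (rule lead_coeff_sum_monom_pos)
  ultimately have "interlaces ?f ?g" if "?f \<noteq> 0" "?g \<noteq> 0"
    using that real_rooted_f real_rooted_g by (intro interlacesI) auto
  \<comment> \<open>If one of the two is zero, interlacing holds by convention.\<close>
  then have "interlaces ?f ?g"
    using real_rooted_f real_rooted_g by (auto simp: interlaces_def)
  with real_rooted_g show ?thesis by blast
qed

end
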